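(* Let $\tau$ be an arbitrary fixed positive real number. Let non-negative numbers $\{u_k\}_{k=1}^N$ be such that $\sum_{k=1}^N u_k=1$ and the greatest common divisor of the indices $k$ with $u_k>0$ equals $1$. Then there exists a function $C$ vanishing at infinity (i.e. $C(t)\to0$ as $t\to+\infty$) such that the following holds. Let $X$ be a continuous function on $\mathbb R$ satisfying $$|X(t)|\le\Pi e^{-\tau t}\quad\text{for all }t\in\mathbb R^+,\qquad X(t)=0\quad\text{for all }t\in\mathbb R^-,$$ where $\Pi>0$. Then there exists a unique continuous function $Z$ on $\mathbb R$ satisfying $$Z(t)=X(t)+\sum_{k=1}^N u_kZ(t-k)\quad\text{for all }t\in\mathbb R^+,\qquad Z(t)=0\quad\text{for all }t\in\mathbb R^-.$$ Moreover, $$|Z(t)-s(t)|\le\Pi\cdot C(t)\quad\text{for all }t\in\mathbb R^+,$$ where the continuous $1$-periodic function $s$ is given by $$s(t)=\frac1J\sum_{k=-\infty}^{+\infty}X(t-k),\quad t\in\mathbb R,\qquad J=\sum_{k=1}^N k\,u_k.$$ In particular, $C$ does not depend on the choice of $X$.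
   Context: $\mathbb R^+$ and $\mathbb R^-$ denote the positive and negative half-lines. *)

theory Defs
  imports "HOL-Analysis.Analysis"
begin

text \<open>The half-lines are open. Since all functions concerned are continuous,
  their values at \<open>0\<close> are determined by those on the negative half-line.\<close>

definition renewal_solution ::
    "(nat \<Rightarrow> real) \<Rightarrow> nat \<Rightarrow> (real \<Rightarrow> real) \<Rightarrow> (real \<Rightarrow> real) \<Rightarrow> bool" where
  "renewal_solution u N X Z \<longleftrightarrow>
     continuous_on UNIV Z \<and>
     (\<forall>t>0. Z t = X t + (\<Sum>k=1..N. u k * Z (t - real k))) \<and>
     (\<forall>t<0. Z t = 0)"

definition mean_index :: "(nat \<Rightarrow> real) \<Rightarrow> nat \<Rightarrow> real" where
  "mean_index u N = (\<Sum>k=1..N. real k * u k)"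

text \<open>\<open>infsum\<close> is \<open>0\<close> for a non-summable family, so summability has to be
  asserted separately wherever this function is used.\<close>

definition periodic_limit ::
    "(nat \<Rightarrow> real) \<Rightarrow> nat \<Rightarrow> (real \<Rightarrow> real) \<Rightarrow> real \<Rightarrow> real" where
  "periodic_limit u N X t =
     1 / mean_index u N * (\<Sum>\<^sub>\<infinity>k\<in>(UNIV :: int set). X (t - of_int k))"

end

theory Submission
  imports Defs
begin

text \<open>
  Write \<open>p\<close> for the probability distribution with weights \<open>u k\<close>, and let \<open>v\<close> be its renewal
  sequence: \<open>v 0 = 1\<close> and \<open>v n = (\<Sum>k=1..n. p k * v (n - k))\<close>. The solution of the renewal equation is
  the convolution \<open>Z t = (\<Sum>n. v n * X (t - n))\<close>, a finite sum for each \<open>t\<close> because \<open>X\<close> vanishes on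
  the negative half-line. Uniqueness follows by stepping to the right from the negative half-line in
  steps of length \<open>1\<close>.

  The analytic input is the renewal theorem \<open>v n \<longlonglongrightarrow> 1 / J\<close> (\<open>renewal_seq_tendsto\<close>), where \<open>J\<close> is the
  mean of \<open>p\<close>. Let \<open>w\<close> be a bounded sequence satisfying the homogeneous recurrence. Its maximum over a
  window of \<open>N\<close> consecutive indices decreases as the window slides to the right, hence tends to some
  \<open>L\<close>. Since \<open>w n\<close> is a weighted average of the values \<open>w (n - k)\<close> with \<open>p k > 0\<close>, and none of these
  exceeds \<open>L\<close> in the limit, \<open>w (g n) \<longlonglongrightarrow> L\<close> along some \<open>g n \<longrightarrow> \<infinity>\<close> forces \<open>w (g n - k) \<longlonglongrightarrow> L\<close> for each such
  \<open>k\<close>, hence for each \<open>k\<close> in the additive semigroup they generate. That semigroup contains all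
  large integers (\<open>numerical_semigroup_cofinite\<close>), so along a suitable sequence of windows all values of \<open>w\<close> tend to \<open>L\<close>. The
  weighted window sum \<open>(\<Sum>j<N. r j * w (n - j))\<close>, with \<open>r j\<close> the tail probabilities of \<open>p\<close>, does not
  depend on \<open>n \<ge> N\<close>, and the \<open>r j\<close> add up to \<open>J\<close>; hence \<open>L\<close> is this constant divided by \<open>J\<close>
  (\<open>recurrence_upper_envelope\<close>). For \<open>w = v\<close> the constant is \<open>1\<close>; using both \<open>v\<close> and \<open>-v\<close> gives the
  limit.

  With \<open>m = \<lfloor>t\<rfloor>\<close>, both \<open>Z t\<close> and \<open>s t\<close> are sums of multiples of \<open>X (t - m + j)\<close> over \<open>j \<ge> 0\<close>. The
  coefficients are \<open>v (m - j)\<close> (\<open>0\<close> if \<open>j > m\<close>) and \<open>1 / J\<close>, and \<open>\<bar>X (t - m + j)\<bar> \<le> K * exp (-\<tau>) ^ j\<close>. So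
  the error is at most \<open>K\<close> times \<open>(\<Sum>j. \<bar>v (m - j) - 1 / J\<bar> * exp (-\<tau>) ^ j)\<close>, which does not involve
  \<open>X\<close> and tends to \<open>0\<close> by Tannery's theorem (\<open>error_bound_tendsto\<close>).
\<close>

section \<open>Numerical semigroups\<close>

text \<open>
  The least positive difference \<open>d\<close> of two elements of \<open>S\<close> divides every element, so \<open>d = 1\<close> and \<open>S\<close>
  contains some \<open>b\<close> and \<open>b + 1\<close>. Every \<open>n \<ge> b\<^sup>2\<close> is then a combination of these: replace \<open>n mod b\<close> of
  the \<open>n div b\<close> summands \<open>b\<close> by \<open>b + 1\<close>.
\<close>

lemma numerical_semigroup_cofinite:
  fixes S :: "nat set"
  assumes zero: "0 \<in> S" and add: "\<And>a b. a \<in> S \<Longrightarrow> b \<in> S \<Longrightarrow> a + b \<in> S" and gcd: "Gcd S = 1"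
  shows "\<exists>n0. \<forall>n\<ge>n0. n \<in> S"
proof -
  have mult: "k * a \<in> S" if "a \<in> S" for k a
    using that by (induction k) (auto intro: zero add)
  define P where "P d \<longleftrightarrow> d > 0 \<and> (\<exists>b\<in>S. b + d \<in> S)" for d
  have "\<exists>s\<in>S. s > 0"
  proof (rule ccontr)
    assume "\<not> ?thesis"
    hence "S \<subseteq> {0}" by auto
    hence "Gcd S = 0" by simp
    thus False using gcd by simp
  qed
  hence "\<exists>d. P d"
    unfolding P_def using zero by (metis add_0)
  define d where "d = (LEAST d. P d)"
  have "P d" unfolding d_def using \<open>\<exists>d. P d\<close> by (rule LeastI_ex)
  then obtain b where d: "d > 0" and b: "b \<in> S" "b + d \<in> S" by (auto simp: P_def)
  have "d dvd s" if s: "s \<in> S" for s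
  proof -
    define k where "k = s div d"
    have "s + k * b = k * (b + d) + s mod d"
      unfolding k_def by (simp add: algebra_simps)
    moreover have "s + k * b \<in> S" "k * (b + d) \<in> S"
      using s b by (auto intro: add mult)
    ultimately have "s mod d > 0 \<Longrightarrow> P (s mod d)" by (auto simp: P_def)
    moreover have "s mod d < d" using d by simp
    ultimately have "s mod d = 0" unfolding d_def using not_less_Least by blast
    thus ?thesis by auto
  qed
  hence "d dvd Gcd S" by (rule Gcd_greatest)
  hence "d = 1" using gcd by simp
  have "n \<in> S" if "n \<ge> b * b" for n
  proof (cases "b = 0")
    case True
    thus ?thesis using b \<open>d = 1\<close> mult[of 1 n] by simp
  next
    case False
    have "n mod b \<le> n div b"
    proof -
      have "b \<le> n div b" using that False by (simp add: less_eq_div_iff_mult_less_eq)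
      moreover have "n mod b < b" using False by simp
      ultimately show ?thesis by linarith
    qed
    hence "(n div b - n mod b) * b + (n mod b) * (b + d) = (n div b) * b + n mod b"
      using \<open>d = 1\<close> by (simp add: algebra_simps diff_mult_distrib2)
    also have "\<dots> = n" by simp
    finally show ?thesis using add[OF mult[OF b(1)] mult[OF b(2)]] by metis
  qed
  thus ?thesis by blast
qed

section \<open>The renewal theorem for finitely supported distributions\<close>

text \<open>
  \<open>renewal_seq p n\<close> is the probability that a random walk from \<open>0\<close> with independent steps
  distributed according to \<open>p\<close> visits \<open>n\<close>. The value \<open>p 0\<close> is not used.
\<close>

fun renewal_seq :: "(nat \<Rightarrow> real) \<Rightarrow> nat \<Rightarrow> real" where
  "renewal_seq p 0 = 1"
| "renewal_seq p (Suc n) = (\<Sum>i\<le>n. p (Suc i) * renewal_seq p (n - i))"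

text \<open>The probability that a step is larger than \<open>j\<close>, for \<open>p\<close> supported on \<open>{1..N}\<close>.\<close>

definition tail_prob :: "(nat \<Rightarrow> real) \<Rightarrow> nat \<Rightarrow> nat \<Rightarrow> real" where
  "tail_prob p N j = (\<Sum>i=j..<N. p (Suc i))"

text \<open>
  A probability distribution on \<open>{1..N}\<close> whose support has greatest common divisor \<open>1\<close>. Sums over
  \<open>{1..N}\<close> are indexed by \<open>i < N\<close> through \<open>k = Suc i\<close>, to match the recursion of \<open>renewal_seq\<close>.
\<close>

locale aperiodic_distribution =
  fixes p :: "nat \<Rightarrow> real" and N :: nat
  assumes p_nonneg: "\<And>k. p k \<ge> 0"
    and p_0: "p 0 = 0"
    and p_support: "\<And>k. k > N \<Longrightarrow> p k = 0"
    and p_sum: "(\<Sum>i<N. p (Suc i)) = 1"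
    and p_gcd: "Gcd {k. p k > 0} = 1"
begin

abbreviation mean :: real where "mean \<equiv> mean_index p N"

lemma mean_eq: "mean = (\<Sum>i<N. real (Suc i) * p (Suc i))"
  by (simp only: mean_index_def One_nat_def sum.atLeast1_atMost_eq)

lemma N_pos: "N > 0"
  using p_sum by (cases N) auto

lemma mean_ge_1: "mean \<ge> 1"
proof -
  have "(\<Sum>i<N. p (Suc i)) \<le> mean"
    unfolding mean_eq
  proof (rule sum_mono)
    fix i
    show "p (Suc i) \<le> real (Suc i) * p (Suc i)"
      using mult_right_mono[of 1 "real (Suc i)" "p (Suc i)"] p_nonneg[of "Suc i"] by simp
  qed
  thus ?thesis using p_sum by simp
qed

lemma sum_tail_prob: "(\<Sum>j<N. tail_prob p N j) = mean"
proof -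
  have "(\<Sum>j<N. tail_prob p N j) = (\<Sum>j<N. \<Sum>i<N. if j \<le> i then p (Suc i) else 0)"
    unfolding tail_prob_def
    by (intro sum.cong refl sum.mono_neutral_cong_left) auto
  also have "\<dots> = (\<Sum>i<N. \<Sum>j<N. if j \<le> i then p (Suc i) else 0)"
    by (rule sum.swap)
  also have "\<dots> = (\<Sum>i<N. \<Sum>j\<le>i. p (Suc i))"
    by (intro sum.cong refl sum.mono_neutral_cong_right) auto
  also have "\<dots> = mean"
    by (simp add: mean_eq)
  finally show ?thesis .
qed

lemma tail_prob_0: "tail_prob p N 0 = 1"
  using p_sum by (simp add: tail_prob_def atLeast0LessThan)

lemma tail_prob_Suc: "tail_prob p N (Suc j) = tail_prob p N j - p (Suc j)"
proof (cases "j < N")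
  case True
  thus ?thesis by (simp add: tail_prob_def sum.atLeast_Suc_lessThan)
next
  case False
  thus ?thesis by (simp add: tail_prob_def p_support)
qed

lemma partial_sum_le_1: "(\<Sum>i\<le>n. p (Suc i)) \<le> 1"
proof -
  have "(\<Sum>i\<le>n. p (Suc i)) \<le> (\<Sum>i<max N (Suc n). p (Suc i))"
    by (rule sum_mono2) (auto simp: p_nonneg)
  also have "\<dots> = (\<Sum>i<N. p (Suc i))"
    by (rule sum.mono_neutral_right) (auto simp: p_support)
  finally show ?thesis using p_sum by simp
qed

lemma renewal_seq_bounds: "0 \<le> renewal_seq p n \<and> renewal_seq p n \<le> 1"
proof (induction n rule: less_induct)
  case (less n)
  show ?case
  proof (cases n)
    case (Suc m)
    have b: "0 \<le> renewal_seq p (m - i) \<and> renewal_seq p (m - i) \<le> 1" for i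
      using less Suc by simp
    have "renewal_seq p n \<ge> 0"
      unfolding Suc renewal_seq.simps by (intro sum_nonneg mult_nonneg_nonneg) (auto simp: b p_nonneg)
    moreover have "renewal_seq p n \<le> (\<Sum>i\<le>m. p (Suc i))"
      unfolding Suc renewal_seq.simps by (intro sum_mono mult_left_le) (auto simp: b p_nonneg)
    ultimately show ?thesis using partial_sum_le_1[of m] by linarith
  qed auto
qed

text \<open>
  The walk is at most \<open>n\<close> for a last time at exactly one position \<open>n - j\<close>, where it makes a step
  larger than \<open>j\<close>; the summands are the probabilities of these events.
\<close>

lemma renewal_seq_tail_convolution: "(\<Sum>j\<le>n. tail_prob p N j * renewal_seq p (n - j)) = 1"
proof (induction n)
  case 0
  show ?case by (simp add: tail_prob_0)
next
  case (Suc n)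
  have "(\<Sum>j\<le>Suc n. tail_prob p N j * renewal_seq p (Suc n - j)) =
      renewal_seq p (Suc n) + (\<Sum>j\<le>n. tail_prob p N (Suc j) * renewal_seq p (n - j))"
    by (subst sum.atMost_Suc_shift) (simp add: tail_prob_0)
  also have "(\<Sum>j\<le>n. tail_prob p N (Suc j) * renewal_seq p (n - j)) = 1 - renewal_seq p (Suc n)"
    using Suc by (simp add: tail_prob_Suc left_diff_distrib sum_subtractf)
  finally show ?case by simp
qed

lemma renewal_seq_conserved:
  assumes "n \<ge> N"
  shows "(\<Sum>j<N. tail_prob p N j * renewal_seq p (n - j)) = 1"
proof -
  have "(\<Sum>j<N. tail_prob p N j * renewal_seq p (n - j)) =
        (\<Sum>j\<le>n. tail_prob p N j * renewal_seq p (n - j))"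
    using assms by (intro sum.mono_neutral_left) (auto simp: tail_prob_def)
  thus ?thesis by (simp add: renewal_seq_tail_convolution)
qed

lemma renewal_seq_recurrence:
  assumes "n \<ge> N"
  shows "renewal_seq p n = (\<Sum>i<N. p (Suc i) * renewal_seq p (n - Suc i))"
proof -
  obtain m where m: "n = Suc m" using assms N_pos by (cases n) auto
  have "renewal_seq p n = (\<Sum>i\<le>m. p (Suc i) * renewal_seq p (n - Suc i))"
    by (simp add: m)
  also have "\<dots> = (\<Sum>i<N. p (Suc i) * renewal_seq p (n - Suc i))"
    using assms m by (intro sum.mono_neutral_right) (auto simp: p_support)
  finally show ?thesis .
qed

text \<open>
  One half of the renewal theorem, for all solutions of the recurrence that are bounded below: the
  envelope \<open>M\<close> shows that the limit superior of \<open>w\<close> is at most \<open>c / mean\<close>. It is stated for general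
  \<open>w\<close> so that it also applies to the negated renewal sequence.
\<close>

lemma recurrence_upper_envelope:
  fixes w :: "nat \<Rightarrow> real"
  assumes rec: "\<And>n. n \<ge> N \<Longrightarrow> w n = (\<Sum>i<N. p (Suc i) * w (n - Suc i))"
    and bdd: "\<And>n. B \<le> w n"
    and cons: "\<And>n. n \<ge> N \<Longrightarrow> (\<Sum>j<N. tail_prob p N j * w (n - j)) = c"
  shows "\<exists>M. (\<forall>n. w n \<le> M n) \<and> M \<longlonglongrightarrow> c / mean"
proof -
  \<comment> \<open>the maximum over the window of length \<open>N\<close> starting at \<open>n\<close>\<close>
  define M where "M n = Max (w ` {n..<n+N})" for n
  have w_le: "w m \<le> M n" if "n \<le> m" "m < n + N" for m n
    unfolding M_def using that by (intro Max_ge) auto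
  have w_le_M: "w n \<le> M n" for n
    using w_le[of n n] N_pos by simp
  have "M (Suc n) \<le> M n" for n
  proof -
    have "w m \<le> M n" if "m \<in> {Suc n..<Suc n+N}" for m
    proof (cases "m < n + N")
      case True
      thus ?thesis using that w_le by simp
    next
      case False
      hence m: "m = n + N" using that by simp
      have "w m = (\<Sum>i<N. p (Suc i) * w (m - Suc i))" using rec m by simp
      also have "\<dots> \<le> (\<Sum>i<N. p (Suc i) * M n)"
        using m by (intro sum_mono mult_left_mono w_le p_nonneg) auto
      also have "\<dots> = M n" using p_sum by (simp flip: sum_distrib_right)
      finally show ?thesis .
    qed
    thus ?thesis unfolding M_def[of "Suc n"] using N_pos by (intro Max.boundedI) auto
  qed
  hence dec: "decseq M" by (rule decseq_SucI)
  have "B \<le> M n" for n using bdd w_le_M order_trans by blast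
  then obtain L where L: "M \<longlonglongrightarrow> L" using decseq_convergent[OF dec] by metis
  have "\<exists>m\<in>{n..<n+N}. w m = M n" for n
    using Max_in[of "w ` {n..<n+N}"] N_pos unfolding M_def by fastforce
  then obtain f where f: "\<And>n. f n \<in> {n..<n+N}" "\<And>n. w (f n) = M n" by metis
  have f_lim: "filterlim f at_top sequentially"
    by (rule filterlim_at_top_mono[OF filterlim_ident]) (use f(1) in auto)
  have shift: "filterlim (\<lambda>n. g n - k) at_top sequentially"
    if "filterlim g at_top sequentially" for g :: "nat \<Rightarrow> nat" and k
    using that filterlim_minus_const_nat_at_top filterlim_compose by blast
  \<comment> \<open>Quantifying over all sequences of indices \<open>g\<close> makes \<open>S\<close> closed under addition.\<close>
  define S where "S = {k. \<forall>g. filterlim g at_top sequentially \<longrightarrow>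
      (\<lambda>n. w (g n)) \<longlonglongrightarrow> L \<longrightarrow> (\<lambda>n. w (g n - k)) \<longlonglongrightarrow> L}"
  have S_zero: "0 \<in> S" by (simp add: S_def)
  have S_add: "a + b \<in> S" if "a \<in> S" "b \<in> S" for a b
    unfolding S_def
  proof safe
    fix g assume g: "filterlim g at_top sequentially" "(\<lambda>n. w (g n)) \<longlonglongrightarrow> L"
    from that(1) g have "(\<lambda>n. w (g n - a)) \<longlonglongrightarrow> L" by (auto simp: S_def)
    with that(2) shift[OF g(1)] have "(\<lambda>n. w (g n - a - b)) \<longlonglongrightarrow> L"
      unfolding S_def by blast
    thus "(\<lambda>n. w (g n - (a + b))) \<longlonglongrightarrow> L" by simp
  qed
  have S_support: "k \<in> S" if k: "p k > 0" for k
    unfolding S_def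
  proof safe
    fix g assume g: "filterlim g at_top sequentially" "(\<lambda>n. w (g n)) \<longlonglongrightarrow> L"
    obtain i where i: "k = Suc i" using k p_0 by (cases k) auto
    have "i < N" using k p_support[of k] i by (metis less_irrefl not_less_eq)
    have M_lim: "(\<lambda>n. M (g n - j)) \<longlonglongrightarrow> L" for j
      using filterlim_compose[OF L shift[OF g(1)]] .
    have "(\<lambda>n. (w (g n) - (1 - p k) * M (g n - N)) / p k) \<longlonglongrightarrow> (L - (1 - p k) * L) / p k"
      using k by (intro tendsto_intros g M_lim) auto
    also have "(L - (1 - p k) * L) / p k = L" using k by (simp add: field_simps)
    finally have low: "(\<lambda>n. (w (g n) - (1 - p k) * M (g n - N)) / p k) \<longlonglongrightarrow> L" .
    have ev: "eventually (\<lambda>n. g n \<ge> N) sequentially"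
      using g(1) by (simp add: filterlim_at_top)
    \<comment> \<open>If \<open>w (g n - k)\<close> were well below \<open>L\<close>, the average \<open>w (g n)\<close> could not be close to \<open>L\<close>.\<close>
    have "eventually (\<lambda>n. (w (g n) - (1 - p k) * M (g n - N)) / p k \<le> w (g n - k)) sequentially"
      using ev
    proof eventually_elim
      case (elim n)
      have split: "(\<Sum>i'<N. h i') = h i + (\<Sum>i'\<in>{..<N} - {i}. h i')" for h :: "nat \<Rightarrow> real"
        using \<open>i < N\<close> by (simp add: sum.remove)
      have "w (g n) = p k * w (g n - k) + (\<Sum>i'\<in>{..<N} - {i}. p (Suc i') * w (g n - Suc i'))"
        using rec[OF elim] split i by simp
      also have "(\<Sum>i'\<in>{..<N} - {i}. p (Suc i') * w (g n - Suc i')) \<le>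
          (\<Sum>i'\<in>{..<N} - {i}. p (Suc i') * M (g n - N))"
        using elim by (intro sum_mono mult_left_mono w_le p_nonneg) auto
      also have "\<dots> = (1 - p k) * M (g n - N)"
        using split[of "\<lambda>i. p (Suc i)"] p_sum i by (simp flip: sum_distrib_right)
      finally show ?case using k by (simp add: field_simps)
    qed
    moreover have "eventually (\<lambda>n. w (g n - k) \<le> M (g n - k)) sequentially"
      by (simp add: w_le_M)
    ultimately show "(\<lambda>n. w (g n - k)) \<longlonglongrightarrow> L"
      by (rule tendsto_sandwich[OF _ _ low M_lim])
  qed
  have "Gcd S dvd Gcd {k. p k > 0}"
    by (rule Gcd_greatest) (auto intro: Gcd_dvd S_support)
  hence "Gcd S = 1" using p_gcd by simp
  then obtain n0 where n0: "\<And>n. n \<ge> n0 \<Longrightarrow> n \<in> S"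
    using numerical_semigroup_cofinite[OF S_zero S_add] by blast
  have "(\<lambda>n. w (f n - n0 - j)) \<longlonglongrightarrow> L" for j
    using n0[of "n0 + j"] f_lim L by (auto simp: S_def f(2))
  hence "(\<lambda>n. \<Sum>j<N. tail_prob p N j * w (f n - n0 - j)) \<longlonglongrightarrow> (\<Sum>j<N. tail_prob p N j * L)"
    by (intro tendsto_intros)
  moreover have "eventually (\<lambda>n. (\<Sum>j<N. tail_prob p N j * w (f n - n0 - j)) = c) sequentially"
  proof -
    have "eventually (\<lambda>n. f n - n0 \<ge> N) sequentially"
      using shift[OF f_lim, of n0] by (auto simp: filterlim_at_top)
    thus ?thesis by eventually_elim (rule cons)
  qed
  ultimately have "(\<Sum>j<N. tail_prob p N j * L) = c"
    by (rule LIMSEQ_unique[OF _ tendsto_eventually])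
  hence "mean * L = c"
    by (simp add: sum_tail_prob flip: sum_distrib_right)
  hence "L = c / mean"
    using mean_ge_1 by (simp add: field_simps)
  thus ?thesis using w_le_M L by blast
qed

theorem renewal_seq_tendsto: "renewal_seq p \<longlonglongrightarrow> 1 / mean"
proof -
  obtain M where M: "\<And>n. renewal_seq p n \<le> M n" "M \<longlonglongrightarrow> 1 / mean"
    using recurrence_upper_envelope[of "renewal_seq p" 0 1]
      renewal_seq_recurrence renewal_seq_conserved renewal_seq_bounds by blast
  have "\<exists>M. (\<forall>n. - renewal_seq p n \<le> M n) \<and> M \<longlonglongrightarrow> (-1) / mean"
    by (rule recurrence_upper_envelope[of _ "-1"])
       (simp_all add: renewal_seq_recurrence[symmetric] renewal_seq_conserved renewal_seq_bounds sum_negf)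
  then obtain M' where M': "\<And>n. - renewal_seq p n \<le> M' n" "M' \<longlonglongrightarrow> (-1) / mean" by blast
  show ?thesis
  proof (rule tendsto_sandwich[OF _ _ _ M(2)])
    show "(\<lambda>n. - M' n) \<longlonglongrightarrow> 1 / mean" using tendsto_minus[OF M'(2)] by simp
    show "eventually (\<lambda>n. - M' n \<le> renewal_seq p n) sequentially"
      using M'(1) by (simp add: minus_le_iff)
  qed (simp add: M(1))
qed

end

section \<open>The solution of the renewal equation\<close>

lemma continuous_zero_at_0:
  fixes f :: "real \<Rightarrow> real"
  assumes "continuous_on UNIV f" "\<And>t. t < 0 \<Longrightarrow> f t = 0"
  shows "f 0 = 0"
proof -
  have "(f \<longlongrightarrow> f 0) (at_left 0)"
    using assms(1) by (auto simp: continuous_on_def intro: tendsto_within_subset)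
  moreover have "eventually (\<lambda>t. f t = 0) (at_left 0)"
    using assms(2) by (auto simp: eventually_at_filter)
  hence "(f \<longlongrightarrow> 0) (at_left 0)" by (rule tendsto_eventually)
  ultimately show ?thesis by (rule tendsto_unique[rotated]) simp
qed

text \<open>
  The renewal equation together with a continuous forcing term \<open>X\<close> that vanishes on the negative
  half-line and decays exponentially on the positive one; \<open>K\<close> is the constant \<open>\<Pi>\<close>.
\<close>

locale renewal_forcing = aperiodic_distribution +
  fixes \<tau> K :: real and X :: "real \<Rightarrow> real"
  assumes tau_pos: "\<tau> > 0"
    and K_pos: "K > 0"
    and X_cont: "continuous_on UNIV X"
    and X_decay: "\<And>t. t > 0 \<Longrightarrow> \<bar>X t\<bar> \<le> K * exp (- \<tau> * t)"
    and X_neg: "\<And>t. t < 0 \<Longrightarrow> X t = 0"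
begin

lemma X_nonpos: "t \<le> 0 \<Longrightarrow> X t = 0"
  using continuous_zero_at_0[OF X_cont X_neg] X_neg by (cases "t = 0") auto

lemma X_bound: "\<bar>X t\<bar> \<le> K * exp (- \<tau> * t)"
  using X_decay[of t] X_nonpos[of t] K_pos by (cases "t > 0") auto

lemma X_comp_cont [continuous_intros]:
  "continuous_on A f \<Longrightarrow> continuous_on A (\<lambda>x. X (f x))"
  by (rule continuous_on_compose2[OF X_cont]) auto

text \<open>
  The convolution of \<open>X\<close> with the renewal sequence; the terms with \<open>n > \<lfloor>t\<rfloor>\<close> vanish. For \<open>t < 0\<close>
  the sum consists of the vanishing term \<open>n = 0\<close>.
\<close>

definition solution :: "real \<Rightarrow> real" where
  "solution t = (\<Sum>n\<le>nat \<lfloor>t\<rfloor>. renewal_seq p n * X (t - real n))"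

lemma solution_eq_sum:
  assumes "t \<le> real M"
  shows "solution t = (\<Sum>n\<le>M. renewal_seq p n * X (t - real n))"
  unfolding solution_def
proof (rule sum.mono_neutral_left)
  show "{..nat \<lfloor>t\<rfloor>} \<subseteq> {..M}" using assms by (auto simp: nat_le_iff) linarith
  show "\<forall>n\<in>{..M} - {..nat \<lfloor>t\<rfloor>}. renewal_seq p n * X (t - real n) = 0"
  proof
    fix n assume "n \<in> {..M} - {..nat \<lfloor>t\<rfloor>}"
    hence "t \<le> real n" by simp linarith
    thus "renewal_seq p n * X (t - real n) = 0" by (simp add: X_nonpos)
  qed
qed auto

lemma solution_cont: "continuous_on UNIV solution"
proof -
  have "continuous_on {..<real M} solution" for M
    by (rule continuous_on_eq[where f = "\<lambda>t. \<Sum>n\<le>M. renewal_seq p n * X (t - real n)"])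
       (auto intro!: continuous_intros solution_eq_sum[symmetric])
  hence "continuous_on (\<Union>M. {..<real M}) solution"
    by (intro continuous_on_open_UN) auto
  moreover have "(\<Union>M. {..<real M}) = UNIV"
    using reals_Archimedean2 by auto
  ultimately show ?thesis by simp
qed

lemma solution_renewal: "renewal_solution p N X solution"
  unfolding renewal_solution_def
proof (intro conjI allI impI)
  show "continuous_on UNIV solution" by (rule solution_cont)
next
  fix t :: real assume "t < 0"
  thus "solution t = 0" by (subst solution_eq_sum[of t 0]) (auto simp: X_nonpos)
next
  fix t :: real assume "t > 0"
  \<comment> \<open>one summation range that is large enough for \<open>t\<close>, for all its shifts and for the support of \<open>p\<close>\<close>
  define M where "M = max N (nat \<lceil>t\<rceil>)"
  have M: "t \<le> real M" "N \<le> M" by (auto simp: M_def) linarith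
  have "solution t = (\<Sum>n\<le>Suc M. renewal_seq p n * X (t - real n))"
    using M by (intro solution_eq_sum) auto
  also have "\<dots> = X t + (\<Sum>n\<le>M. \<Sum>i\<le>n. p (Suc i) * (renewal_seq p (n - i) * X (t - real (Suc n))))"
    by (subst sum.atMost_Suc_shift) (simp add: sum_distrib_right mult.assoc)
  also have "(\<Sum>n\<le>M. \<Sum>i\<le>n. p (Suc i) * (renewal_seq p (n - i) * X (t - real (Suc n)))) =
     (\<Sum>n\<le>M. \<Sum>i\<le>n. (\<lambda>i j. p (Suc i) * (renewal_seq p j * X (t - real (Suc (i + j))))) i (n - i))"
    by (intro sum.cong refl) simp
  also have "\<dots> = (\<Sum>(i,j)\<in>{(i,j). i + j \<le> M}. p (Suc i) * (renewal_seq p j * X (t - real (Suc (i + j)))))"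
    by (rule sum.triangle_reindex_eq[symmetric])
  also have "\<dots> = (\<Sum>(i,j)\<in>{..M} \<times> {..M}. p (Suc i) * (renewal_seq p j * X (t - real (Suc (i + j)))))"
  proof (rule sum.mono_neutral_left)
    show "\<forall>x\<in>{..M} \<times> {..M} - {(i,j). i + j \<le> M}.
        (case x of (i,j) \<Rightarrow> p (Suc i) * (renewal_seq p j * X (t - real (Suc (i + j))))) = 0"
      using M by (auto intro!: X_nonpos)
  qed auto
  also have "\<dots> = (\<Sum>i\<le>M. p (Suc i) * (\<Sum>j\<le>M. renewal_seq p j * X (t - real (Suc i) - real j)))"
    by (subst sum.cartesian_product[symmetric]) (simp add: sum_distrib_left algebra_simps)
  also have "\<dots> = (\<Sum>i\<le>M. p (Suc i) * solution (t - real (Suc i)))"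
    using M by (intro sum.cong refl arg_cong2[of _ _ _ _ "(*)"] solution_eq_sum[symmetric]) auto
  also have "\<dots> = (\<Sum>i<N. p (Suc i) * solution (t - real (Suc i)))"
    using M by (intro sum.mono_neutral_right) (auto simp: p_support)
  finally show "solution t = X t + (\<Sum>k=1..N. p k * solution (t - real k))"
    by (simp only: One_nat_def sum.atLeast1_atMost_eq)
qed

lemma renewal_solution_unique:
  assumes "renewal_solution p N X Z" "renewal_solution p N X Z'"
  shows "Z = Z'"
proof -
  define D where "D t = Z t - Z' t" for t
  have cont: "continuous_on UNIV D"
    using assms unfolding renewal_solution_def D_def by (auto intro: continuous_on_diff)
  have neg: "D t = 0" if "t < 0" for t
    using assms that by (simp add: renewal_solution_def D_def)
  have zero: "D t = 0" if "t \<le> 0" for t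
    using continuous_zero_at_0[OF cont neg] neg that by (cases "t = 0") auto
  have rec: "D t = (\<Sum>k=1..N. p k * D (t - real k))" if "t > 0" for t
  proof -
    have "Z t = X t + (\<Sum>k=1..N. p k * Z (t - real k))"
         "Z' t = X t + (\<Sum>k=1..N. p k * Z' (t - real k))"
      using assms that unfolding renewal_solution_def by blast+
    thus ?thesis by (simp add: D_def right_diff_distrib sum_subtractf)
  qed
  have "D t = 0" if "t \<le> real m" for t m
    using that
  proof (induction m arbitrary: t)
    case (Suc m)
    show ?case
    proof (cases "t > 0")
      case True
      have "D (t - real k) = 0" if "k \<in> {1..N}" for k
        using Suc that by simp
      thus ?thesis by (simp add: rec[OF True])
    qed (simp add: zero)
  qed (simp add: zero)
  hence "D t = 0" for t using real_arch_simple by blast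
  thus ?thesis by (auto simp: D_def)
qed

section \<open>The periodic limit\<close>

text \<open>
  The terms with \<open>k > m\<close> vanish, and \<open>k = m - j\<close> enumerates the others. Only \<open>t < m + 1\<close> is needed, so
  one representation by a series holds on a whole neighbourhood of each point.
\<close>

lemma periodization_has_sum:
  fixes m :: int
  assumes "t < of_int m + 1"
  shows "summable (\<lambda>j. norm (X (t - of_int m + real j)))"
    and "((\<lambda>k::int. X (t - of_int k)) has_sum (\<Sum>j. X (t - of_int m + real j))) UNIV"
proof -
  show *: "summable (\<lambda>j. norm (X (t - of_int m + real j)))"
  proof (rule summable_comparison_test')
    show "summable (\<lambda>j. K * exp (- \<tau> * (t - of_int m)) * exp (- \<tau>) ^ j)"
      using tau_pos by (intro summable_mult summable_geometric) auto
    show "norm (norm (X (t - of_int m + real j))) \<le> K * exp (- \<tau> * (t - of_int m)) * exp (- \<tau>) ^ j" for j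
      using X_bound[of "t - of_int m + real j"]
      by (simp add: algebra_simps flip: exp_of_nat_mult exp_add)
  qed
  have "((\<lambda>j. X (t - of_int m + real j)) has_sum (\<Sum>j. X (t - of_int m + real j))) UNIV"
    by (intro norm_summable_imp_has_sum * summable_sums summable_norm_cancel)
  also have "?this \<longleftrightarrow> ((\<lambda>k::int. X (t - of_int k)) has_sum (\<Sum>j. X (t - of_int m + real j))) {..m}"
    by (rule has_sum_reindex_bij_witness[of _ "\<lambda>k. nat (m - k)" "\<lambda>j. m - int j"]) (auto simp: algebra_simps)
  also have "\<dots> \<longleftrightarrow> ((\<lambda>k::int. X (t - of_int k)) has_sum (\<Sum>j. X (t - of_int m + real j))) UNIV"
  proof (rule has_sum_cong_neutral)
    fix k :: int assume "k \<in> UNIV - {..m}"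
    hence "real_of_int m + 1 \<le> of_int k" by simp
    thus "X (t - of_int k) = 0" using assms by (intro X_nonpos) linarith
  qed auto
  finally show "((\<lambda>k::int. X (t - of_int k)) has_sum (\<Sum>j. X (t - of_int m + real j))) UNIV" .
qed

lemma periodic_limit_eq:
  "t < of_int m + 1 \<Longrightarrow> periodic_limit p N X t = 1 / mean * (\<Sum>j. X (t - of_int m + real j))"
  unfolding periodic_limit_def using periodization_has_sum(2) infsumI by metis

lemma periodic_limit_cont: "continuous_on UNIV (periodic_limit p N X)"
proof -
  have "continuous_on {of_int m - 1<..<of_int m + 1} (periodic_limit p N X)" for m :: int
  proof -
    let ?A = "{of_int m - 1<..<of_int m + 1} :: real set"
    have "uniform_limit ?A (\<lambda>n t. \<Sum>j<n. X (t - of_int m + real j))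
        (\<lambda>t. \<Sum>j. X (t - of_int m + real j)) sequentially"
    proof (rule Weierstrass_m_test)
      show "summable (\<lambda>j. K * exp \<tau> * exp (- \<tau>) ^ j)"
        using tau_pos by (intro summable_mult summable_geometric) auto
      fix j :: nat and t :: real assume t: "t \<in> ?A"
      have "\<bar>X (t - of_int m + real j)\<bar> \<le> K * exp (- \<tau> * (t - of_int m + real j))"
        by (rule X_bound)
      also have "\<dots> = K * exp (- \<tau> * (t - of_int m)) * exp (- \<tau>) ^ j"
        by (simp add: algebra_simps flip: exp_of_nat_mult exp_add)
      also have "\<dots> \<le> K * exp \<tau> * exp (- \<tau>) ^ j"
      proof -
        have "\<tau> * (of_int m - t) \<le> \<tau> * 1" using t tau_pos by (intro mult_left_mono) auto
        thus ?thesis using K_pos by (intro mult_right_mono mult_left_mono) (auto simp: algebra_simps)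
      qed
      finally show "norm (X (t - of_int m + real j)) \<le> K * exp \<tau> * exp (- \<tau>) ^ j" by simp
    qed
    hence "continuous_on ?A (\<lambda>t. \<Sum>j. X (t - of_int m + real j))"
      by (rule uniform_limit_theorem[rotated]) (auto intro!: always_eventually continuous_intros)
    hence "continuous_on ?A (\<lambda>t. 1 / mean * (\<Sum>j. X (t - of_int m + real j)))"
      by (intro continuous_intros)
    thus ?thesis
      by (rule continuous_on_eq) (rule periodic_limit_eq[symmetric], simp)
  qed
  hence "continuous_on (\<Union>m::int. {of_int m - 1<..<of_int m + 1}) (periodic_limit p N X)"
    by (intro continuous_on_open_UN) auto
  moreover have "t \<in> {of_int \<lfloor>t\<rfloor> - 1<..<of_int \<lfloor>t\<rfloor> + 1}" for t :: real
    by simp linarith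
  hence "(\<Union>m::int. {of_int m - 1<..<of_int m + 1 :: real}) = UNIV" by blast
  ultimately show ?thesis by simp
qed

lemma periodic_limit_periodic: "periodic_limit p N X (t + 1) = periodic_limit p N X t"
proof -
  have "(\<Sum>\<^sub>\<infinity>k\<in>UNIV. X (t - of_int k)) = (\<Sum>\<^sub>\<infinity>k\<in>UNIV. X (t + 1 - of_int k))"
    by (rule infsum_reindex_bij_witness[of _ "\<lambda>k. k - 1" "\<lambda>k. k + 1"]) auto
  thus ?thesis by (simp add: periodic_limit_def)
qed

end

section \<open>The error bound\<close>

context aperiodic_distribution
begin

text \<open>
  The coefficient of \<open>X (t - m + j)\<close> in the difference of the solution and the periodic limit at
  \<open>t\<close>, where \<open>m = \<lfloor>t\<rfloor>\<close>.
\<close>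

definition coeff_error :: "nat \<Rightarrow> nat \<Rightarrow> real" where
  "coeff_error m j = (if j \<le> m then renewal_seq p (m - j) else 0) - 1 / mean"

text \<open>The error for \<open>K = 1\<close>, with every value of the forcing term replaced by its bound.\<close>

definition error_bound :: "real \<Rightarrow> real \<Rightarrow> real" where
  "error_bound \<tau> t = (\<Sum>j. \<bar>coeff_error (nat \<lfloor>t\<rfloor>) j\<bar> * exp (- \<tau>) ^ j)"

lemma coeff_error_le_1: "\<bar>coeff_error m j\<bar> \<le> 1"
proof -
  have "0 \<le> 1 / mean" "1 / mean \<le> 1" using mean_ge_1 by auto
  thus ?thesis using renewal_seq_bounds[of "m - j"] unfolding coeff_error_def by (simp only: split: if_split) linarith
qed

lemma coeff_error_tendsto: "(\<lambda>m. coeff_error m j) \<longlonglongrightarrow> 0"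
proof -
  have "(\<lambda>m. renewal_seq p (m - j) - 1 / mean) \<longlonglongrightarrow> 1 / mean - 1 / mean"
    by (intro tendsto_intros filterlim_compose[OF renewal_seq_tendsto] filterlim_minus_const_nat_at_top)
  hence "(\<lambda>m. renewal_seq p (m - j) - 1 / mean) \<longlonglongrightarrow> 0" by simp
  thus ?thesis
    by (rule Lim_transform_eventually)
       (auto simp: coeff_error_def intro: eventually_mono[OF eventually_ge_at_top[of j]])
qed

lemma error_bound_tendsto:
  assumes "\<tau> > 0"
  shows "(error_bound \<tau> \<longlongrightarrow> 0) at_top"
proof -
  have "((\<lambda>m. \<Sum>j. \<bar>coeff_error m j\<bar> * exp (- \<tau>) ^ j) \<longlongrightarrow> (\<Sum>j. 0 * exp (- \<tau>) ^ j)) sequentially"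
  proof (rule tannerys_theorem[THEN conjunct2, THEN conjunct2])
    show "(\<lambda>m. \<bar>coeff_error m j\<bar> * exp (- \<tau>) ^ j) \<longlonglongrightarrow> 0 * exp (- \<tau>) ^ j" for j
      by (intro tendsto_intros tendsto_rabs_zero coeff_error_tendsto)
    show "eventually (\<lambda>(j, m). norm (\<bar>coeff_error m j\<bar> * exp (- \<tau>) ^ j) \<le> exp (- \<tau>) ^ j)
        (sequentially \<times>\<^sub>F sequentially)"
      by (auto intro!: always_eventually mult_left_le_one_le simp: abs_mult coeff_error_le_1)
    show "summable (\<lambda>j. exp (- \<tau>) ^ j)"
      using assms by (intro summable_geometric) auto
  qed simp
  hence "(\<lambda>m. \<Sum>j. \<bar>coeff_error m j\<bar> * exp (- \<tau>) ^ j) \<longlonglongrightarrow> 0" by simp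
  moreover have "filterlim (\<lambda>t::real. nat \<lfloor>t\<rfloor>) sequentially at_top"
    by (intro filterlim_compose[OF filterlim_nat_sequentially] filterlim_floor_sequentially)
  ultimately show ?thesis
    unfolding error_bound_def [abs_def] by (rule filterlim_compose)
qed

end

context renewal_forcing
begin

lemma solution_approx:
  assumes t: "t > 0"
  shows "\<bar>solution t - periodic_limit p N X t\<bar> \<le> K * error_bound \<tau> t"
proof -
  define m where "m = nat \<lfloor>t\<rfloor>"
  have m: "real m \<le> t" "t < real m + 1" using t by (auto simp: m_def)
  let ?x = "\<lambda>j. X (t - real m + real j)"
  have summ_norm: "summable (\<lambda>j. norm (?x j))"
    using periodization_has_sum(1)[of t "int m"] m by simp
  hence summ: "summable ?x" by (rule summable_norm_cancel)
  have "solution t = (\<Sum>j\<le>m. renewal_seq p (m - j) * X (t - real (m - j)))"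
    unfolding solution_def m_def[symmetric]
    by (rule sum.reindex_bij_witness[of _ "\<lambda>j. m - j" "\<lambda>j. m - j"]) auto
  also have "\<dots> = (\<Sum>j\<le>m. (if j \<le> m then renewal_seq p (m - j) else 0) * ?x j)"
    by (intro sum.cong refl) (auto simp: algebra_simps of_nat_diff)
  finally have "(\<lambda>j. (if j \<le> m then renewal_seq p (m - j) else 0) * ?x j) sums solution t"
    using sums_finite[of "{..m}" "\<lambda>j. (if j \<le> m then renewal_seq p (m - j) else 0) * ?x j"] by auto
  moreover have "(\<lambda>j. 1 / mean * ?x j) sums periodic_limit p N X t"
    using periodic_limit_eq[of t "int m"] m sums_mult[OF summable_sums[OF summ], of "1 / mean"] by simp
  ultimately have sums: "(\<lambda>j. coeff_error m j * ?x j) sums (solution t - periodic_limit p N X t)"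
    using sums_diff by (fastforce simp: coeff_error_def left_diff_distrib)
  have le: "norm (coeff_error m j * ?x j) \<le> K * (\<bar>coeff_error m j\<bar> * exp (- \<tau>) ^ j)" for j
  proof -
    have "\<bar>?x j\<bar> \<le> K * exp (- \<tau> * (t - real m + real j))" by (rule X_bound)
    also have "\<dots> \<le> K * exp (- \<tau> * real j)"
      using K_pos tau_pos m by (intro mult_left_mono) auto
    also have "\<dots> = K * exp (- \<tau>) ^ j" by (simp add: algebra_simps flip: exp_of_nat_mult)
    finally have "\<bar>coeff_error m j\<bar> * \<bar>?x j\<bar> \<le> \<bar>coeff_error m j\<bar> * (K * exp (- \<tau>) ^ j)"
      by (rule mult_left_mono) simp
    thus ?thesis by (simp add: abs_mult mult_ac)
  qed
  have "summable (\<lambda>j. \<bar>coeff_error m j\<bar> * exp (- \<tau>) ^ j)"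
  proof (rule summable_comparison_test')
    show "summable (\<lambda>j. exp (- \<tau>) ^ j)" using tau_pos by (intro summable_geometric) auto
    show "norm (\<bar>coeff_error m j\<bar> * exp (- \<tau>) ^ j) \<le> exp (- \<tau>) ^ j" for j
      by (auto intro!: mult_left_le_one_le simp: abs_mult coeff_error_le_1)
  qed
  hence "norm (\<Sum>j. coeff_error m j * ?x j) \<le> (\<Sum>j. K * (\<bar>coeff_error m j\<bar> * exp (- \<tau>) ^ j))"
    by (intro norm_suminf_le summable_mult le)
  also have "\<dots> = K * error_bound \<tau> t"
    unfolding error_bound_def m_def[symmetric] by (intro suminf_mult) fact
  finally show ?thesis using sums by (simp add: sums_iff)
qed

end

section \<open>Convergence to the periodic limit\<close>

theorem mainTheorem3:
  fixes \<tau> :: real and u :: "nat \<Rightarrow> real" and N :: nat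
  assumes "\<tau> > 0"
    and "\<And>k. k \<in> {1..N} \<Longrightarrow> u k \<ge> 0"
    and "(\<Sum>k=1..N. u k) = 1"
    and "Gcd {k \<in> {1..N}. u k > 0} = 1"
  shows "\<exists>C :: real \<Rightarrow> real. (C \<longlongrightarrow> 0) at_top \<and>
    (\<forall>(X :: real \<Rightarrow> real) (K :: real).
       K > 0 \<and> continuous_on UNIV X \<and>
       (\<forall>t>0. \<bar>X t\<bar> \<le> K * exp (- \<tau> * t)) \<and> (\<forall>t<0. X t = 0) \<longrightarrow>
       (\<exists>!Z. renewal_solution u N X Z) \<and>
       (\<forall>t. (\<lambda>k::int. X (t - of_int k)) summable_on UNIV) \<and>
       continuous_on UNIV (periodic_limit u N X) \<and>
       (\<forall>t. periodic_limit u N X (t + 1) = periodic_limit u N X t) \<and>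
       (\<forall>Z. renewal_solution u N X Z \<longrightarrow>
          (\<forall>t>0. \<bar>Z t - periodic_limit u N X t\<bar> \<le> K * C t)))"
proof -
  \<comment> \<open>Only \<open>u 1, \<dots>, u N\<close> are constrained, so the other values are replaced by \<open>0\<close>.\<close>
  define p where "p k = (if k \<in> {1..N} then u k else 0)" for k
  have sum_p: "(\<Sum>k=1..N. p k) = 1"
    using assms(3) by (simp add: p_def)
  have supp: "{k. p k > 0} = {k \<in> {1..N}. u k > 0}"
    by (auto simp: p_def)
  interpret aperiodic_distribution p N
  proof
    show "(\<Sum>i<N. p (Suc i)) = 1"
      using sum_p by (simp only: One_nat_def sum.atLeast1_atMost_eq)
    show "Gcd {k. p k > 0} = 1" using assms(4) supp by simp
  qed (use assms(2) in \<open>auto simp: p_def\<close>)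
  have solution_u: "renewal_solution u N X = renewal_solution p N X" for X
    by (simp add: renewal_solution_def p_def fun_eq_iff)
  have "mean_index u N = mean_index p N"
    by (simp add: mean_index_def p_def)
  hence limit_u: "periodic_limit u N X = periodic_limit p N X" for X
    by (simp add: periodic_limit_def fun_eq_iff)
  show ?thesis
  proof (intro exI conjI allI impI; (elim conjE)?)
    show "(error_bound \<tau> \<longlongrightarrow> 0) at_top"
      using assms(1) by (rule error_bound_tendsto)
  next
    fix X :: "real \<Rightarrow> real" and K :: real
    assume X: "K > 0" "continuous_on UNIV X" "\<forall>t>0. \<bar>X t\<bar> \<le> K * exp (- \<tau> * t)" "\<forall>t<0. X t = 0"
    interpret renewal_forcing p N \<tau> K X
      by unfold_locales (use assms(1) X in auto)
    show "\<exists>!Z. renewal_solution u N X Z"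
      unfolding solution_u using solution_renewal renewal_solution_unique by blast
    show "(\<lambda>k::int. X (t - of_int k)) summable_on UNIV" for t
      using periodization_has_sum(2)[of t "\<lfloor>t\<rfloor>"] by (auto intro: has_sum_imp_summable)
    show "continuous_on UNIV (periodic_limit u N X)"
      unfolding limit_u by (rule periodic_limit_cont)
    show "periodic_limit u N X (t + 1) = periodic_limit u N X t" for t
      unfolding limit_u by (rule periodic_limit_periodic)
    show "\<bar>Z t - periodic_limit u N X t\<bar> \<le> K * error_bound \<tau> t"
      if "renewal_solution u N X Z" "t > 0" for Z t
    proof -
      have "Z = solution"
        using that(1) unfolding solution_u by (rule renewal_solution_unique[OF _ solution_renewal])
      thus ?thesis using solution_approx[OF that(2)] by (simp add: limit_u)
    qed
  qed
qed

end
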